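(* Let $G$ be a finite caterpillar graph with at least one edge, and let $\Delta$ be the maximum degree of $G$. Then $d(G)=\left\lceil\frac{\Delta}{2}\right\rceil$.
   Context: A vertex labeling of a graph $G$ is an injective map $f:V(G)\to\mathbb{Z}$. It induces the edge labeling $f^-:E(G)\to\mathbb{Z}$, $f^-(uv)=|f(u)-f(v)|$, and $|f^-|$ denotes the number of distinct values $f^-$ takes on $E(G)$. The difference index $d(G)$ is the minimum positive integer $k$ such that there exists a vertex labeling $f$ of $G$ with $|f^-|=k$. A caterpillar graph is a tree that consists of a central path such that every other vertex is at distance $1$ from a cut vertex on this central path. *)

theory Defs
  imports "Graph_Theory.Graph_Theory"
begin

text \<open>
  Finite simple graphs are represented by the locale \<^locale>\<open>graph\<close>: finite symmetric loop-free
  digraphs without parallel arcs, so that every edge \<open>uv\<close> is a pair of opposite arcs.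
\<close>

text \<open>
  The constant \<^const>\<open>tree\<close> cannot be used here: in a symmetric digraph the two arcs of any edge
  already form a \<^const>\<open>pre_digraph.cycle\<close> (of length 2).  The cycles of the undirected graph are
  those of length at least 3.
\<close>
definition undirected_tree :: "('a, 'b) pre_digraph \<Rightarrow> bool" where
  "undirected_tree G \<longleftrightarrow>
     Digraph_Component.connected G \<and> \<not> (\<exists>p. pre_digraph.cycle G p \<and> 3 \<le> length p)"

text \<open>
  In a symmetric digraph, the strongly connected components are the connected components of the
  undirected graph; deleting a cut vertex increases their number.
\<close>
definition cut_vertex :: "('a, 'b) pre_digraph \<Rightarrow> 'a \<Rightarrow> bool" where
  "cut_vertex G v \<longleftrightarrow> v \<in> verts G \<and>
     card (pre_digraph.sccs G) < card (pre_digraph.sccs (pre_digraph.del_vert G v))"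

text \<open>
  With unit arc costs, the shortest-path cost \<^const>\<open>wf_digraph.\<mu>\<close> is the graph distance.
\<close>
definition graph_distance :: "('a, 'b) pre_digraph \<Rightarrow> 'a \<Rightarrow> 'a \<Rightarrow> ereal" where
  "graph_distance G u v = wf_digraph.\<mu> G (\<lambda>_. 1) u v"

text \<open>
  The central path may consist of a single vertex (stars), or of all vertices (paths).
\<close>
definition caterpillar :: "('a, 'b) pre_digraph \<Rightarrow> bool" where
  "caterpillar G \<longleftrightarrow> undirected_tree G \<and>
     (\<exists>p. vpath p G \<and>
       (\<forall>w \<in> verts G - set p. \<exists>c \<in> set p. cut_vertex G c \<and> graph_distance G w c = 1))"

definition vertex_labeling :: "('a, 'b) pre_digraph \<Rightarrow> ('a \<Rightarrow> int) \<Rightarrow> bool" where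
  "vertex_labeling G f \<longleftrightarrow> inj_on f (verts G)"

text \<open>The two arcs of an edge receive the same label.\<close>
definition edge_label :: "('a, 'b) pre_digraph \<Rightarrow> ('a \<Rightarrow> int) \<Rightarrow> 'b \<Rightarrow> int" where
  "edge_label G f e = \<bar>f (tail G e) - f (head G e)\<bar>"

definition difference_index :: "('a, 'b) pre_digraph \<Rightarrow> nat" where
  "difference_index G =
     (LEAST k. 0 < k \<and> (\<exists>f. vertex_labeling G f \<and> card (edge_label G f ` arcs G) = k))"

text \<open>In a simple graph, the arcs leaving a vertex correspond to its incident edges.\<close>
definition max_degree :: "('a, 'b) pre_digraph \<Rightarrow> nat" where
  "max_degree G = Max (out_degree G ` verts G)"

end

theory Submission
  imports Defs
begin

text \<open>
  Lower bound. The labels at a vertex \<open>v\<close> are the distances from \<open>f v\<close> to the integers assigned to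
  its neighbours. These integers are distinct and only two integers lie at a given positive distance
  from \<open>f v\<close>, so a label occurs at most twice at \<open>v\<close>, and at least \<open>\<Delta>/2\<close> labels occur at a vertex of
  degree \<open>\<Delta>\<close> (\<open>max_degree_le_twice_card_labels\<close>).

  Upper bound. Let \<open>k\<close> be \<open>\<Delta>/2\<close> rounded up. Place the \<open>i\<close>-th vertex of the central path at \<open>2ki\<close> and
  each vertex off the path within distance \<open>k - 1\<close> of its neighbour on the path. The blocks of integers
  at distance less than \<open>k\<close> from the multiples of \<open>2k\<close> are disjoint, so the labeling is injective
  once it is injective in each block, and all edges are labeled \<open>2k\<close> (along the path) or
  \<open>1, ..., k - 1\<close> (off the path): \<open>k\<close> labels in all. A block has \<open>2k - 2\<close> places besides its centre.
  An inner vertex of the path has two neighbours on the path, hence at most \<open>\<Delta> - 2 \<le> 2k - 2\<close> others,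
  which fit (\<open>card_off_path_neighbours\<close>). An end of the path could have more, but not if the path is
  as long as possible: an end with a neighbour off the path could be continued by that neighbour, so
  the ends of a longest central path have none (\<open>caterpillar_maximal_spine\<close>).

  The labels of all edges are accounted for because a tree has only two kinds of edges relative to
  such a path: between consecutive path vertices, and from a vertex off the path to its unique
  neighbour on the path. Any other edge would close a segment of the path to a cycle
  (\<open>tree_path_chord\<close>, \<open>tree_off_path_neighbour_unique\<close>, \<open>tree_off_path_nonadjacent\<close>).
\<close>

section \<open>Paths in a symmetric digraph\<close>

text \<open>
  Adjacency stated for successive list entries makes the extension, concatenation and indexing
  lemmas on lists available for paths.
\<close>
lemma (in wf_digraph) vpath_iff_successively:
  "vpath p G \<longleftrightarrow> p \<noteq> [] \<and> set p \<subseteq> verts G \<and> successively (dominates G) p \<and> distinct p"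
proof -
  have "set (vwalk_arcs p) \<subseteq> arcs_ends G \<longleftrightarrow> successively (dominates G) p"
    by (induction p rule: vwalk_arcs.induct) auto
  then show ?thesis
    by (auto simp: vpath_def vwalk_def)
qed

lemma (in wf_digraph) vpath_segment:
  assumes p: "vpath p G" and ij: "i \<le> j" "j < length p"
  obtains q where "vpath q G" "hd q = p ! i" "last q = p ! j" "set q \<subseteq> set p"
    "length q = Suc (j - i)"
proof
  let ?q = "map ((!) p) [i..<Suc j]"
  have *: "set p \<subseteq> verts G" "successively (dominates G) p" "distinct p"
    using p by (auto simp: vpath_iff_successively)
  have sub: "set ?q \<subseteq> set p"
    using ij by auto
  have "successively (dominates G) ?q"
    using *(2) ij by (auto simp: successively_conv_nth simp del: upt_Suc)
  moreover have "distinct ?q"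
    using *(3) ij by (auto simp: distinct_map inj_on_def nth_eq_iff_index_eq simp del: upt_Suc)
  ultimately show "vpath ?q G"
    using sub *(1) ij by (auto simp: vpath_iff_successively simp del: upt_Suc)
  show "hd ?q = p ! i" "last ?q = p ! j" "length ?q = Suc (j - i)"
    using ij by (auto simp: hd_map last_map simp del: upt_Suc)
  show "set ?q \<subseteq> set p" by (fact sub)
qed

text \<open>
  Paths are handled as vertex lists but cycles are lists of arcs; this translates the former into the
  latter.
\<close>
lemma (in wf_digraph) vwalk_imp_awalk:
  assumes "vwalk q G"
  shows "\<exists>es. awalk (hd q) es (last q) \<and> awalk_verts (hd q) es = q"
  using assms
proof (induction q rule: list.induct)
  case Nil
  then show ?case by (auto simp: vwalk_def)
next
  case (Cons x q)
  show ?case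
  proof (cases q)
    case Nil
    with Cons.prems show ?thesis
      by (intro exI[of _ "[]"]) (auto simp: vwalk_def awalk_Nil_iff)
  next
    case (Cons y r)
    then have xy: "x \<rightarrow> y" and q: "vwalk q G"
      using Cons.prems by (auto simp: vwalk_def)
    obtain es where es: "awalk y es (last q)" "awalk_verts y es = q"
      using Cons.IH[OF q] Cons by auto
    obtain e where "e \<in> arcs G" "tail G e = x" "head G e = y"
      using xy by (rule reachableE)
    then show ?thesis
      using es Cons by (intro exI[of _ "e # es"]) (auto simp: awalk_Cons_iff)
  qed
qed

text \<open>
  An arc between the ends would close the path to a cycle. With only two vertices on the path this
  cycle runs back and forth along one edge, which is harmless in an undirected tree; hence the bound
  on the length.
\<close>
lemma (in wf_digraph) undirected_tree_path_ends_nonadjacent: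
  assumes "undirected_tree G" and q: "vpath q G" "3 \<le> length q"
  shows "\<not> last q \<rightarrow> hd q"
proof
  assume "last q \<rightarrow> hd q"
  then obtain e where e: "e \<in> arcs G" "tail G e = last q" "head G e = hd q"
    by (rule reachableE)
  obtain es where es: "awalk (hd q) es (last q)" "awalk_verts (hd q) es = q"
    using q vwalk_imp_awalk by blast
  have "awalk (last q) [e] (hd q)"
    using e head_in_verts[OF e(1)] by (auto simp: awalk_Cons_iff awalk_Nil_iff)
  with es have w: "awalk (hd q) (es @ [e]) (hd q)"
    by (auto intro: awalk_appendI)
  have "awalk_verts (hd q) (es @ [e]) = q @ [hd q]"
    using awalk_verts_append[OF w] es e by simp
  moreover have "distinct (tl (q @ [hd q]))"
    using q by (cases q) auto
  ultimately have "cycle (es @ [e])"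
    using w by (auto simp: cycle_def)
  moreover have "length (es @ [e]) = length q"
    using es(2) length_awalk_verts[of "hd q" es] by simp
  ultimately show False
    using assms(1) q(2) unfolding undirected_tree_def by metis
qed

section \<open>Adjacency along a spine\<close>

text \<open>
  The distance is an infimum of natural numbers, so distance 1 yields a walk of length less than 2,
  and a walk between distinct vertices is not empty.
\<close>
lemma (in wf_digraph) graph_distance_one_imp_adjacent:
  assumes d: "graph_distance G u v = 1" and "u \<noteq> v"
  shows "u \<rightarrow> v"
proof -
  have cost: "awalk_cost (\<lambda>_. 1) es = real (length es)" for es
    by (induction es) auto
  have "(INF es \<in> {es. awalk u es v}. ereal (awalk_cost (\<lambda>_. 1) es)) < 2"
    using d unfolding graph_distance_def \<mu>_def by simp
  then obtain es where es: "awalk u es v" "ereal (real (length es)) < 2"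
    by (auto simp: Inf_less_iff cost)
  from es(2) have "length es < 2"
    by (metis ereal_less_eq(3) not_le numeral_eq_ereal of_nat_less_iff of_nat_numeral ereal_less(2) less_ereal.simps(1))
  moreover have "es \<noteq> []"
    using es(1) \<open>u \<noteq> v\<close> by (auto simp: awalk_Nil_iff)
  ultimately obtain e where "es = [e]"
    by (cases es) (auto simp: Suc_less_eq)
  with es(1) show ?thesis
    by (auto simp: awalk_Cons_iff awalk_Nil_iff arcs_ends_conv)
qed

context graph
begin

lemma adjacent_sym: "u \<rightarrow> v \<Longrightarrow> v \<rightarrow> u"
  using arcs_ends_symmetric[OF sym_arcs] .

text \<open>
  The segment between the ends of a chord, together with the chord, is a cycle.
\<close>
lemma tree_path_chord:
  assumes T: "undirected_tree G" and p: "vpath p G"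
    and ij: "i < j" "j < length p" and adj: "p ! i \<rightarrow> p ! j"
  shows "j = Suc i"
proof (rule ccontr)
  assume "j \<noteq> Suc i"
  obtain q where q: "vpath q G" "hd q = p ! i" "last q = p ! j" "length q = Suc (j - i)"
    using vpath_segment[OF p, of i j] ij by auto
  moreover have "3 \<le> length q"
    using q(4) ij \<open>j \<noteq> Suc i\<close> by simp
  ultimately show False
    using undirected_tree_path_ends_nonadjacent[OF T, of q] adjacent_sym[OF adj] by simp
qed

text \<open>
  A vertex with two neighbours on the path forms a cycle with the segment between them.
\<close>
lemma tree_off_path_neighbour_unique:
  assumes T: "undirected_tree G" and p: "vpath p G" and w: "w \<notin> set p"
    and i: "i < length p" "w \<rightarrow> p ! i" and j: "j < length p" "w \<rightarrow> p ! j"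
  shows "i = j"
  using i j
proof (induction i j rule: linorder_wlog)
  case (le i j)
  show ?case
  proof (rule ccontr)
    assume "i \<noteq> j"
    obtain q where q: "vpath q G" "hd q = p ! i" "last q = p ! j" "set q \<subseteq> set p"
      "length q = Suc (j - i)"
      using vpath_segment[OF p, of i j] le by auto
    have "vpath (w # q) G"
      using q w le adj_in_verts[of w "p ! i"]
      by (auto simp: vpath_iff_successively successively_Cons)
    moreover have "3 \<le> length (w # q)"
      using q(5) le \<open>i \<noteq> j\<close> by simp
    moreover have "last (w # q) \<rightarrow> hd (w # q)"
      using q le adjacent_sym by auto
    ultimately show False
      using undirected_tree_path_ends_nonadjacent[OF T] by blast
  qed
qed simp

text \<open>
  Two adjacent vertices off the path and the segment between their path neighbours form a cycle; if
  the path neighbours coincide, it is a triangle.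
\<close>
lemma tree_off_path_nonadjacent:
  assumes T: "undirected_tree G" and p: "vpath p G"
    and u: "u \<notin> set p" "i < length p" "u \<rightarrow> p ! i"
    and v: "v \<notin> set p" "j < length p" "v \<rightarrow> p ! j"
  shows "\<not> u \<rightarrow> v"
  using u v
proof (induction i j arbitrary: u v rule: linorder_wlog)
  case (le i j)
  show ?case
  proof
    assume uv: "u \<rightarrow> v"
    obtain q where q: "vpath q G" "hd q = p ! i" "last q = p ! j" "set q \<subseteq> set p"
      "length q = Suc (j - i)"
      using vpath_segment[OF p, of i j] le by auto
    have "u \<noteq> v"
      using uv adj_not_same by blast
    moreover have "p ! j \<rightarrow> v"
      using le adjacent_sym by blast
    ultimately have "vpath (u # q @ [v]) G"
      using q le adj_in_verts[OF uv]
      by (auto simp: vpath_iff_successively successively_Cons successively_append_iff)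
    moreover have "3 \<le> length (u # q @ [v])"
      using q(5) by simp
    moreover have "last (u # q @ [v]) \<rightarrow> hd (u # q @ [v])"
      using adjacent_sym[OF uv] by simp
    ultimately show False
      using undirected_tree_path_ends_nonadjacent[OF T] by blast
  qed
next
  case (sym i j)
  then show ?case using adjacent_sym by blast
qed

text \<open>
  Among the paths that dominate all other vertices a longest one is taken. Continuing it beyond an end
  by a neighbour off the path would preserve domination, so no such neighbour exists. This treats
  all vertices of the path alike in the labeling: neither end needs more room than an inner vertex.
\<close>
lemma caterpillar_maximal_spine:
  assumes "caterpillar G"
  obtains p where "vpath p G"
    "\<forall>w \<in> verts G - set p. \<exists>c \<in> set p. w \<rightarrow> c"
    "\<forall>w \<in> verts G - set p. \<not> hd p \<rightarrow> w \<and> \<not> last p \<rightarrow> w"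
proof -
  define spine where "spine p \<longleftrightarrow> vpath p G \<and> (\<forall>w \<in> verts G - set p. \<exists>c \<in> set p. w \<rightarrow> c)" for p
  obtain p0 where "vpath p0 G"
    "\<forall>w \<in> verts G - set p0. \<exists>c \<in> set p0. graph_distance G w c = 1"
    using assms unfolding caterpillar_def by blast
  then have "spine p0"
    unfolding spine_def using graph_distance_one_imp_adjacent by (metis DiffE)
  moreover have "\<forall>p. spine p \<longrightarrow> length p < Suc (card (verts G))"
    by (metis spine_def vpath_iff_successively distinct_card card_mono finite_verts less_Suc_eq_le)
  ultimately obtain p where p: "spine p" and max: "\<And>q. spine q \<Longrightarrow> length q \<le> length p"
    using ex_has_greatest_nat[of spine p0 length] by blast
  have path: "p \<noteq> []" "set p \<subseteq> verts G" "successively (dominates G) p" "distinct p"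
    using p by (auto simp: spine_def vpath_iff_successively)
  have "\<not> hd p \<rightarrow> w \<and> \<not> last p \<rightarrow> w" if w: "w \<in> verts G - set p" for w
  proof (intro conjI notI)
    assume "hd p \<rightarrow> w"
    then have "spine (w # p)"
      using p w path adjacent_sym
      by (auto simp: spine_def vpath_iff_successively successively_Cons)
    then show False using max by fastforce
  next
    assume "last p \<rightarrow> w"
    then have "spine (p @ [w])"
      using p w path
      by (auto simp: spine_def vpath_iff_successively successively_append_iff)
    then show False using max by fastforce
  qed
  then show thesis
    using that[of p] p unfolding spine_def by blast
qed

section \<open>The number of neighbours off the spine\<close>

lemma out_degree_eq_card_neighbours: "out_degree G v = card {w. v \<rightarrow> w}"
proof -
  have "bij_betw (head G) (out_arcs G v) {w. v \<rightarrow> w}"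
    unfolding bij_betw_def
  proof
    show "inj_on (head G) (out_arcs G v)"
      by (intro inj_onI no_multi_arcs) (auto simp: arc_to_ends_def)
    show "head G ` out_arcs G v = {w. v \<rightarrow> w}"
      by (auto simp: arcs_ends_conv)
  qed
  then show ?thesis
    unfolding out_degree_def by (rule bij_betw_same_card)
qed

lemma finite_neighbours: "finite {w. v \<rightarrow> w}"
  by (rule finite_subset[OF _ finite_verts]) (auto dest: adj_in_verts)

lemma out_degree_le_max_degree:
  assumes "v \<in> verts G"
  shows "out_degree G v \<le> max_degree G"
  unfolding max_degree_def using assms by (intro Max_ge) auto

lemma card_off_path_neighbours:
  assumes p: "vpath p G" and i: "0 < i" "Suc i < length p"
  shows "card {w \<in> verts G - set p. p ! i \<rightarrow> w} + 2 \<le> max_degree G"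
proof -
  let ?L = "{w \<in> verts G - set p. p ! i \<rightarrow> w}"
  let ?S = "{p ! (i - 1), p ! Suc i}"
  have path: "set p \<subseteq> verts G" "successively (dominates G) p" "distinct p"
    using p by (auto simp: vpath_iff_successively)
  have step: "p ! j \<rightarrow> p ! Suc j" if "Suc j < length p" for j
    using path(2) that by (auto simp: successively_conv_nth)
  have "p ! (i - 1) \<noteq> p ! Suc i"
    using path(3) i by (simp add: nth_eq_iff_index_eq)
  then have "card ?L + 2 = card ?L + card ?S"
    by simp
  also have "\<dots> = card (?L \<union> ?S)"
    using i by (intro card_Un_disjoint[symmetric]) auto
  also have "\<dots> \<le> card {w. p ! i \<rightarrow> w}"
    using step[of i] adjacent_sym[OF step[of "i - 1"]] i
    by (intro card_mono finite_neighbours) auto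
  also have "\<dots> \<le> max_degree G"
    using out_degree_le_max_degree[of "p ! i"] path(1) i nth_mem[of i p]
    by (simp add: out_degree_eq_card_neighbours subset_iff)
  finally show ?thesis .
qed

section \<open>The two bounds\<close>

lemma max_degree_le_twice_card_labels:
  assumes f: "vertex_labeling G f" and "verts G \<noteq> {}"
  shows "max_degree G \<le> 2 * card (edge_label G f ` arcs G)"
proof -
  have "out_degree G v \<le> 2 * card (edge_label G f ` arcs G)" if "v \<in> verts G" for v
  proof -
    \<comment> \<open>The label of an arc at \<open>v\<close> and the side of \<open>f v\<close> on which its other end lies determine the arc.\<close>
    let ?h = "\<lambda>e. (edge_label G f e, f (head G e) < f v)"
    have "inj_on ?h (out_arcs G v)"
    proof (rule inj_onI)
      fix e e' assume e: "e \<in> out_arcs G v" "e' \<in> out_arcs G v" and eq: "?h e = ?h e'"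
      then have "f (head G e) = f (head G e')"
        by (auto simp: edge_label_def abs_if split: if_splits)
      then have "head G e = head G e'"
        using f e by (auto simp: vertex_labeling_def inj_on_def)
      then show "e = e'"
        using e by (intro no_multi_arcs) (auto simp: arc_to_ends_def)
    qed
    then have "card (out_arcs G v) \<le> card (edge_label G f ` arcs G \<times> (UNIV :: bool set))"
      by (rule card_inj_on_le) (auto simp: finite_cartesian_product)
    then show ?thesis
      by (simp add: out_degree_def card_cartesian_product)
  qed
  then show ?thesis
    unfolding max_degree_def using assms(2) by (subst Max_le_iff) auto
qed

lemma caterpillar_labeling:
  assumes cat: "caterpillar G" and k: "max_degree G \<le> 2 * k" "0 < k"
  shows "\<exists>f. vertex_labeling G f \<and> card (edge_label G f ` arcs G) \<le> k"
proof -
  have T: "undirected_tree G"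
    using cat by (simp add: caterpillar_def)
  obtain p where p: "vpath p G"
    and dom: "\<forall>w \<in> verts G - set p. \<exists>c \<in> set p. w \<rightarrow> c"
    and ends: "\<forall>w \<in> verts G - set p. \<not> hd p \<rightarrow> w \<and> \<not> last p \<rightarrow> w"
    using caterpillar_maximal_spine[OF cat] .
  have path: "p \<noteq> []" "distinct p"
    using p by (auto simp: vpath_iff_successively)
  define L where "L i = {w \<in> verts G - set p. p ! i \<rightarrow> w}" for i
  \<comment> \<open>The admissible offsets of a vertex off the path from its neighbour on the path; 0 is taken by that
    neighbour.\<close>
  define D where "D = {- (int k - 1)..int k - 1} - {0}"
  have D: "finite D" "card D = 2 * k - 2"
    using k(2) by (auto simp: D_def card_Diff_singleton_if)
  have finL: "finite (L i)" for i
    by (simp add: L_def)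
  have cardL: "card (L i) \<le> card D" if i: "i < length p" for i
  proof (cases "i = 0 \<or> Suc i = length p")
    case True
    then have "p ! i = hd p \<or> p ! i = last p"
      using path(1) i by (metis diff_Suc_1 hd_conv_nth last_conv_nth)
    then have "L i = {}"
      using ends by (auto simp: L_def)
    then show ?thesis by simp
  next
    case False
    then show ?thesis
      using card_off_path_neighbours[OF p, of i] i k D by (simp add: L_def)
  qed
  have "\<forall>i\<in>{..<length p}. \<exists>g. inj_on g (L i) \<and> g ` L i \<subseteq> D"
    using cardL finL D(1) inj_on_iff_card_le by (metis lessThan_iff)
  from bchoice[OF this] obtain g where g: "\<And>i. i < length p \<Longrightarrow> inj_on (g i) (L i)"
      "\<And>i. i < length p \<Longrightarrow> g i ` L i \<subseteq> D"
    by auto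
  have "\<exists>i<length p. v = p ! i \<or> v \<notin> set p \<and> v \<rightarrow> p ! i" if "v \<in> verts G" for v
    using dom that by (metis DiffI in_set_conv_nth)
  then obtain pos where pos: "\<And>v. v \<in> verts G \<Longrightarrow> pos v < length p"
      "\<And>v. v \<in> verts G \<Longrightarrow> v = p ! pos v \<or> v \<notin> set p \<and> v \<rightarrow> p ! pos v"
    by metis
  have pos_spine: "p ! pos v = v" if "v \<in> verts G" "v \<in> set p" for v
    using pos that by metis
  have adjacent_pos: "v \<rightarrow> p ! pos v" if "v \<in> verts G" "v \<notin> set p" for v
    using pos[OF that(1)] that(2) nth_mem by metis
  have in_L: "v \<in> L (pos v)" if "v \<in> verts G" "v \<notin> set p" for v
    using that adjacent_sym[OF adjacent_pos[OF that]] by (simp add: L_def)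
  define off where "off v = (if v \<in> set p then 0 else g (pos v) v)" for v
  define f where "f v = 2 * int k * int (pos v) + off v" for v
  have off_leaf: "off v \<in> D" if "v \<in> verts G" "v \<notin> set p" for v
    using that g(2)[OF pos(1), of v] in_L by (auto simp: off_def)
  have off_bound: "\<bar>off v\<bar> < int k" if "v \<in> verts G" for v
    using off_leaf[OF that] k(2) by (cases "v \<in> set p") (auto simp: off_def D_def)
  have inj: "inj_on f (verts G)"
  proof (rule inj_onI)
    fix u v assume uv: "u \<in> verts G" "v \<in> verts G" and "f u = f v"
    then have eq: "2 * int k * (int (pos u) - int (pos v)) = off v - off u"
      by (simp add: f_def algebra_simps)
    \<comment> \<open>The difference of the offsets is a multiple of \<open>2k\<close> of modulus less than \<open>2k\<close>.\<close>
    have "\<bar>off v - off u\<bar> < 2 * int k"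
      using off_bound[OF uv(1)] off_bound[OF uv(2)] by linarith
    with eq have "2 * int k * \<bar>int (pos u) - int (pos v)\<bar> < 2 * int k * 1"
      using abs_mult[of "2 * int k" "int (pos u) - int (pos v)"] by simp
    then have same: "pos u = pos v"
      using k(2) by (subst (asm) mult_less_cancel_left_pos) auto
    have off: "off u = off v"
      using eq unfolding same by simp
    show "u = v"
    proof (cases "u \<in> set p \<longleftrightarrow> v \<in> set p")
      case True
      show ?thesis
      proof (cases "u \<in> set p")
        case True
        with \<open>u \<in> set p \<longleftrightarrow> v \<in> set p\<close> have "p ! pos u = u" "p ! pos v = v"
          using pos_spine uv by simp_all
        then show ?thesis
          unfolding same by (rule trans[OF sym])
      next
        case False
        with True have outside: "u \<notin> set p" "v \<notin> set p"
          by simp_all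
        have "g (pos u) u = g (pos u) v"
          using off outside by (simp add: off_def same)
        moreover have "u \<in> L (pos u)" "v \<in> L (pos u)"
          using in_L[OF uv(1) outside(1)] in_L[OF uv(2) outside(2)] unfolding same .
        ultimately show ?thesis
          using g(1)[OF pos(1)[OF uv(1)]] by (auto dest: inj_onD)
      qed
    next
      case False
      then show ?thesis
        using off off_leaf[OF uv(1)] off_leaf[OF uv(2)] by (auto simp: off_def D_def)
    qed
  qed
  have "edge_label G f ` arcs G \<subseteq> insert (2 * int k) {1..int k - 1}"
  proof -
    have spine: "\<bar>f u - f v\<bar> = 2 * int k"
      if "u \<rightarrow> v" "u \<in> set p" "v \<in> set p" for u v
    proof -
      have V: "u \<in> verts G" "v \<in> verts G" "u \<noteq> v"
        using that adj_in_verts adj_not_same by blast+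
      have "p ! pos u \<rightarrow> p ! pos v" "p ! pos v \<rightarrow> p ! pos u" "pos u \<noteq> pos v"
        using that(1) adjacent_sym[OF that(1)] V(3) pos_spine[OF V(1) that(2)]
          pos_spine[OF V(2) that(3)] by auto
      then have "pos v = Suc (pos u) \<or> pos u = Suc (pos v)"
        using tree_path_chord[OF T p, of "pos u" "pos v"] tree_path_chord[OF T p, of "pos v" "pos u"]
          pos(1)[OF V(1)] pos(1)[OF V(2)] by linarith
      then show ?thesis
        using that by (auto simp: f_def off_def algebra_simps)
    qed
    have leaf: "\<bar>f u - f v\<bar> \<in> {1..int k - 1}"
      if "u \<rightarrow> v" "u \<notin> set p" "v \<in> set p" for u v
    proof -
      have V: "u \<in> verts G" "v \<in> verts G"
        using that adj_in_verts by blast+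
      have "pos u = pos v"
        using tree_off_path_neighbour_unique[OF T p that(2), of "pos u" "pos v"]
          pos(1)[OF V(1)] pos(1)[OF V(2)] adjacent_pos[OF V(1) that(2)] that(1)
          pos_spine[OF V(2) that(3)] by simp
      then have "f u - f v = off u"
        using that by (auto simp: f_def off_def)
      then show ?thesis
        using off_leaf[OF V(1) that(2)] by (auto simp: D_def)
    qed
    have off_spine: False if "u \<rightarrow> v" "u \<notin> set p" "v \<notin> set p" for u v
      using tree_off_path_nonadjacent[OF T p that(2) _ _ that(3), of "pos u" "pos v"]
        that pos(1) adjacent_pos adj_in_verts[OF that(1)] by simp
    have "\<bar>f u - f v\<bar> \<in> insert (2 * int k) {1..int k - 1}" if "u \<rightarrow> v" for u v
      using spine[OF that] leaf[OF that] leaf[OF adjacent_sym[OF that]] off_spine[OF that]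
        abs_minus_commute[of "f u" "f v"]
      by (cases "u \<in> set p"; cases "v \<in> set p") simp_all
    then show ?thesis
      by (auto simp del: insert_iff simp: edge_label_def arcs_ends_conv)
  qed
  then have "card (edge_label G f ` arcs G) \<le> card (insert (2 * int k) {1..int k - 1})"
    by (intro card_mono) simp_all
  moreover have "card (insert (2 * int k) {1..int k - 1}) = k"
    using k(2) by (simp add: nat_diff_distrib)
  ultimately have "card (edge_label G f ` arcs G) \<le> k"
    by simp
  with inj show ?thesis
    unfolding vertex_labeling_def by blast
qed

end

theorem theorem3p7:
  fixes G :: "('a, 'b) pre_digraph"
  assumes "graph G"
    and "caterpillar G"
    and "arcs G \<noteq> {}"
  shows "int (difference_index G) = \<lceil>real (max_degree G) / 2\<rceil>"
proof -
  interpret graph G by (fact assms(1))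
  define k where "k = (max_degree G + 1) div 2"
  obtain e where e: "e \<in> arcs G"
    using assms(3) by blast
  have "0 < out_degree G (tail G e)"
    unfolding out_degree_def using e finite_out_arcs by (auto simp: card_gt_0_iff)
  then have "0 < max_degree G"
    using out_degree_le_max_degree[of "tail G e"] e by simp
  then have k: "0 < k" "max_degree G \<le> 2 * k"
    by (auto simp: k_def)
  have lower: "k \<le> card (edge_label G f ` arcs G)" if "vertex_labeling G f" for f
    using max_degree_le_twice_card_labels[OF that] e tail_in_verts unfolding k_def by fastforce
  obtain f where f: "vertex_labeling G f" "card (edge_label G f ` arcs G) \<le> k"
    using caterpillar_labeling[OF assms(2) k(2,1)] by blast
  have "difference_index G = k"
    unfolding difference_index_def
  proof (rule Least_equality)
    show "0 < k \<and> (\<exists>f. vertex_labeling G f \<and> card (edge_label G f ` arcs G) = k)"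
      using f lower[OF f(1)] k by (metis le_antisym)
  qed (use lower in blast)
  moreover have "\<lceil>real (max_degree G) / 2\<rceil> = int k"
    unfolding k_def by (rule ceiling_unique) linarith+
  ultimately show ?thesis by simp
qed

end
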